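(* The map $\mathcal K$ defined by $$\mathcal K(D\mid I,u)=\sum_{k\in\mathsf J}\vartheta_k(I,u)\,\mathbf 1_D\bigl(\Psi(I,u,k)\bigr),\qquad D\in\mathcal B(\mathcal I),$$ is a stochastic kernel on $(\mathcal I,\mathcal B(\mathcal I))$ given the graph $\operatorname{Gr}(\mathcal U)=\{(I,u)\in\mathcal I\times\mathcal U:\ u\in\mathcal U(I)\}$. Its value is independent of the arbitrary choices of $\rho_k$ on zero-probability branches.
   Context: Model. $\mathcal X$ (states), $\mathcal U$ (actions), $\mathsf E$, $\mathsf V$ (noises) are standard Borel spaces, $G:\mathcal X\times\mathcal U\times\mathsf E\times\mathsf V\to\mathcal X$ is Borel measurable, $\nu_\eta,\nu_\varepsilon$ are probability measures on $\mathsf E,\mathsf V$, and $Q(C\mid x,u)=\int_{\mathsf E}\int_{\mathsf V}\mathbf 1_C(G(x,u,e,v))\,\nu_\varepsilon(dv)\,\nu_\eta(de)$. $\mathcal P(\mathcal X)$ is the set of probability measures on $\mathcal X$ with the $\sigma$-field generated by the evaluations $\mu\mapsto\mu(C)$, $C\in\mathcal B(\mathcal X)$. The observable classes $O_1,\dots,O_{r+1}$ are pairwise disjoint measurable sets with union $\mathcal X$ (unions of cells of a finite measurable partition of $\mathcal X$; $O_{r+1}$, the complement of $O_1\cup\dots\cup O_r$, may be empty). $\mathsf J=\{j\in\{1,\dots,r+1\}:O_j\ne\varnothing\}$. Filter operators. For $\mu\in\mathcal P(\mathcal X)$, $u\in\mathcal U$, $k\in\mathsf J$: $(\mathcal L_u\mu)(C)=\int_{\mathcal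 X}Q(C\mid x,u)\,\mu(dx)$; $\widetilde{\mathcal L}_{u,k}\mu(C)=(\mathcal L_u\mu)(C\cap O_k)$; $p_k(\mu,u)=(\mathcal L_u\mu)(O_k)$. For each $k\in\mathsf J$ fix $\rho_k\in\mathcal P(\mathcal X)$ with $\rho_k(O_k)=1$; $\Phi_k(\mu,u)=\widetilde{\mathcal L}_{u,k}\mu/p_k(\mu,u)$ if $p_k(\mu,u)>0$ and $\Phi_k(\mu,u)=\rho_k$ otherwise. Information space. $\mathcal P_j=\{\mu\in\mathcal P(\mathcal X):\mu(O_j)=1\}$, $\mathcal I=\bigcup_{j\in\mathsf J}(\{j\}\times\mathcal P_j)$ with the trace $\sigma$-field $\mathcal B(\mathcal I)$ of $\mathsf J\times\mathcal P(\mathcal X)$. With $\mathcal U(x)\subseteq\mathcal U$ the nonempty set of admissible actions at the hidden state $x$, the admissible actions at $I=(j,\mu)$ are $\mathcal U(I)=\{u\in\mathcal U:\mu(\{x:u\in\mathcal U(x)\})=1\}$. For $I=(j,\mu)$: $\vartheta_k(I,u)=p_k(\mu,u)$ and $\Psi(I,u,k)=(k,\Phi_k(\mu,u))$. A stochastic kernel given the graph is a map that is a probability measure in $D$ for each $(I,u)$ in the graph and measurable in $(I,u)\in\operatorname{Gr}(\mathcal U)$ (trace $\sigma$-field) for each $D$. *)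

theory Defs
  imports "HOL-Probability.Probability"
begin

definition standard_borel_space :: "'a measure \<Rightarrow> bool" where
  "standard_borel_space M \<longleftrightarrow>
     (\<exists>T. completely_metrizable_space T \<and> second_countable T \<and>
          topspace T = space M \<and> sets M = sigma_sets (topspace T) {S. openin T S})"

text \<open>
  The state, action and noise spaces are measures \<open>X\<close>, \<open>U\<close>, \<open>E\<close>, \<open>V\<close> of which only the
  underlying measurable space is used. The set \<open>\<P>(X)\<close> with its evaluation \<open>\<sigma>\<close>-field is
  \<open>prob_algebra X\<close>. All probabilities are valued in \<open>ennreal\<close>.
\<close>

definition transition_kernel ::
    "('x \<times> 'u \<times> 'e \<times> 'v \<Rightarrow> 'x) \<Rightarrow> 'e measure \<Rightarrow> 'v measure \<Rightarrow> 'x set \<Rightarrow> 'x \<Rightarrow> 'u \<Rightarrow> ennreal" where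
  "transition_kernel G \<nu>\<eta> \<nu>\<epsilon> C x u = (\<integral>\<^sup>+ e. \<integral>\<^sup>+ v. indicator C (G (x, u, e, v)) \<partial>\<nu>\<epsilon> \<partial>\<nu>\<eta>)"

text \<open>
  Below, \<open>Q C x u\<close> is a transition kernel and \<open>Obs j\<close> is the observable class \<open>O\<^sub>j\<close>. In the
  definitions by \<open>measure_of\<close>, the given set function is a measure on \<open>sets X\<close> whenever \<open>Q\<close>
  is a stochastic kernel, \<open>Obs k\<close> is measurable, \<open>\<mu>\<close> is a probability measure on \<open>X\<close>,
  \<open>u\<close> is in \<open>space U\<close> and, for \<open>filter_update\<close>, \<open>branch_prob\<close> is positive; so its values are
  not replaced by \<open>0\<close>.
\<close>

definition predict :: "'x measure \<Rightarrow> ('x set \<Rightarrow> 'x \<Rightarrow> 'u \<Rightarrow> ennreal) \<Rightarrow> 'u \<Rightarrow> 'x measure \<Rightarrow> 'x measure" where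
  "predict X Q u \<mu> = measure_of (space X) (sets X) (\<lambda>C. \<integral>\<^sup>+ x. Q C x u \<partial>\<mu>)"

definition predict_on ::
    "'x measure \<Rightarrow> ('x set \<Rightarrow> 'x \<Rightarrow> 'u \<Rightarrow> ennreal) \<Rightarrow> (nat \<Rightarrow> 'x set) \<Rightarrow> 'u \<Rightarrow> nat \<Rightarrow> 'x measure \<Rightarrow> 'x measure" where
  "predict_on X Q Obs u k \<mu> =
     measure_of (space X) (sets X) (\<lambda>C. emeasure (predict X Q u \<mu>) (C \<inter> Obs k))"

definition branch_prob ::
    "'x measure \<Rightarrow> ('x set \<Rightarrow> 'x \<Rightarrow> 'u \<Rightarrow> ennreal) \<Rightarrow> (nat \<Rightarrow> 'x set) \<Rightarrow> nat \<Rightarrow> 'x measure \<Rightarrow> 'u \<Rightarrow> ennreal" where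
  "branch_prob X Q Obs k \<mu> u = emeasure (predict X Q u \<mu>) (Obs k)"

definition filter_update ::
    "'x measure \<Rightarrow> ('x set \<Rightarrow> 'x \<Rightarrow> 'u \<Rightarrow> ennreal) \<Rightarrow> (nat \<Rightarrow> 'x set) \<Rightarrow> (nat \<Rightarrow> 'x measure) \<Rightarrow>
     nat \<Rightarrow> 'x measure \<Rightarrow> 'u \<Rightarrow> 'x measure" where
  "filter_update X Q Obs \<rho> k \<mu> u =
     (if branch_prob X Q Obs k \<mu> u > 0
      then measure_of (space X) (sets X)
             (\<lambda>C. emeasure (predict_on X Q Obs u k \<mu>) C / branch_prob X Q Obs k \<mu> u)
      else \<rho> k)"

definition class_indices :: "nat \<Rightarrow> (nat \<Rightarrow> 'x set) \<Rightarrow> nat set" where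
  "class_indices r Obs = {j \<in> {1..r + 1}. Obs j \<noteq> {}}"

definition class_probs :: "'x measure \<Rightarrow> (nat \<Rightarrow> 'x set) \<Rightarrow> nat \<Rightarrow> 'x measure set" where
  "class_probs X Obs j = {\<mu> \<in> space (prob_algebra X). emeasure \<mu> (Obs j) = 1}"

definition info_space :: "'x measure \<Rightarrow> nat \<Rightarrow> (nat \<Rightarrow> 'x set) \<Rightarrow> (nat \<times> 'x measure) measure" where
  "info_space X r Obs =
     restrict_space (count_space (class_indices r Obs) \<Otimes>\<^sub>M prob_algebra X)
       (SIGMA j:class_indices r Obs. class_probs X Obs j)"

text \<open>
  \<open>Adm x\<close> is the set of admissible actions at the hidden state \<open>x\<close>. Since \<open>emeasure\<close> is \<open>0\<close> on
  non-measurable sets, an action \<open>u\<close> for which \<open>{x. u \<in> Adm x}\<close> is not measurable is not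
  admissible at any information state.
\<close>

definition info_actions ::
    "'x measure \<Rightarrow> 'u measure \<Rightarrow> ('x \<Rightarrow> 'u set) \<Rightarrow> nat \<times> 'x measure \<Rightarrow> 'u set" where
  "info_actions X U Adm I = {u \<in> space U. emeasure (snd I) {x \<in> space X. u \<in> Adm x} = 1}"

definition info_graph ::
    "'x measure \<Rightarrow> 'u measure \<Rightarrow> nat \<Rightarrow> (nat \<Rightarrow> 'x set) \<Rightarrow> ('x \<Rightarrow> 'u set) \<Rightarrow>
     ((nat \<times> 'x measure) \<times> 'u) set" where
  "info_graph X U r Obs Adm =
     {(I, u). I \<in> space (info_space X r Obs) \<and> u \<in> space U \<and> u \<in> info_actions X U Adm I}"

definition \<theta> ::
    "'x measure \<Rightarrow> ('x set \<Rightarrow> 'x \<Rightarrow> 'u \<Rightarrow> ennreal) \<Rightarrow> (nat \<Rightarrow> 'x set) \<Rightarrow>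
     nat \<Rightarrow> nat \<times> 'x measure \<Rightarrow> 'u \<Rightarrow> ennreal" where
  "\<theta> X Q Obs k I u = branch_prob X Q Obs k (snd I) u"

definition \<Psi> ::
    "'x measure \<Rightarrow> ('x set \<Rightarrow> 'x \<Rightarrow> 'u \<Rightarrow> ennreal) \<Rightarrow> (nat \<Rightarrow> 'x set) \<Rightarrow> (nat \<Rightarrow> 'x measure) \<Rightarrow>
     nat \<times> 'x measure \<Rightarrow> 'u \<Rightarrow> nat \<Rightarrow> nat \<times> 'x measure" where
  "\<Psi> X Q Obs \<rho> I u k = (k, filter_update X Q Obs \<rho> k (snd I) u)"

definition info_kernel ::
    "'x measure \<Rightarrow> ('x set \<Rightarrow> 'x \<Rightarrow> 'u \<Rightarrow> ennreal) \<Rightarrow> nat \<Rightarrow> (nat \<Rightarrow> 'x set) \<Rightarrow> (nat \<Rightarrow> 'x measure) \<Rightarrow>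
     (nat \<times> 'x measure) set \<Rightarrow> nat \<times> 'x measure \<Rightarrow> 'u \<Rightarrow> ennreal" where
  "info_kernel X Q r Obs \<rho> D I u =
     (\<Sum>k\<in>class_indices r Obs. \<theta> X Q Obs k I u * indicator D (\<Psi> X Q Obs \<rho> I u k))"

definition stochastic_kernel_given ::
    "'i measure \<Rightarrow> 'u measure \<Rightarrow> ('i \<times> 'u) set \<Rightarrow> ('i set \<Rightarrow> 'i \<Rightarrow> 'u \<Rightarrow> ennreal) \<Rightarrow> bool" where
  "stochastic_kernel_given S U Gr \<kappa> \<longleftrightarrow>
     (\<forall>(s, u)\<in>Gr. measure_space (space S) (sets S) (\<lambda>D. \<kappa> D s u) \<and> \<kappa> (space S) s u = 1) \<and>
     (\<forall>D\<in>sets S. (\<lambda>(s, u). \<kappa> D s u) \<in> borel_measurable (restrict_space (S \<Otimes>\<^sub>M U) Gr))"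

end

theory Submission
  imports Defs
begin

text \<open>
  The content is that the explicitly normalised filter is an ordinary measurable operation on
  probability kernels. The transition law \<open>Q(\<cdot> | x, u)\<close> is the image of the product noise law
  under \<open>G(x, u, \<cdot>)\<close>, hence a measurable map into \<open>\<P>(X)\<close>. The prediction step is the Giry
  composition of \<open>\<mu>\<close> with this kernel, so \<open>(\<mu>, u) \<mapsto> \<L>\<^sub>u\<mu>\<close> is measurable into \<open>\<P>(X)\<close>
  (\<open>measurable_predict\<close>), and so are its evaluations \<open>p\<^sub>k\<close>. On \<open>{p\<^sub>k > 0}\<close> the update is
  conditioning of \<open>\<L>\<^sub>u\<mu>\<close> on \<open>O\<^sub>k\<close>, each of whose evaluations is a quotient of measurable functions; on
  \<open>{p\<^sub>k = 0}\<close> it is constant. Hence \<open>\<Phi>\<^sub>k\<close> is measurable into \<open>\<P>(X)\<close>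
  (\<open>measurable_filter_update\<close>), and since both branches charge only \<open>O\<^sub>k\<close>, the map
  \<open>\<Psi>(\<cdot>, \<cdot>, k)\<close> is measurable into the information space (\<open>measurable_\<Psi>\<close>).

  The set function \<open>\<K>(\<cdot> | I, u)\<close> is then a finite combination of point masses with weights \<open>p\<^sub>k\<close>,
  measurable in \<open>(I, u)\<close>; the weights add up to \<open>1\<close> because the classes partition \<open>X\<close>
  (\<open>sum_branch_prob\<close>). The choice of \<open>\<rho>\<^sub>k\<close> enters only through terms whose weight \<open>p\<^sub>k\<close> is \<open>0\<close>.
\<close>

section \<open>Finite mixtures of point masses\<close>

lemma measure_space_finite_point_masses:
  fixes M :: "'a measure" and w :: "'k \<Rightarrow> ennreal"
  shows "measure_space (space M) (sets M) (\<lambda>D. \<Sum>k\<in>J. w k * indicator D (y k))"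
  unfolding measure_space_def
proof (intro conjI)
  show "sigma_algebra (space M) (sets M)" ..
  show "positive (sets M) (\<lambda>D. \<Sum>k\<in>J. w k * indicator D (y k))"
    by (simp add: positive_def)
  show "countably_additive (sets M) (\<lambda>D. \<Sum>k\<in>J. w k * indicator D (y k))"
  proof (rule countably_additiveI)
    fix A :: "nat \<Rightarrow> 'a set" assume "disjoint_family A"
    then show "(\<Sum>i. \<Sum>k\<in>J. w k * indicator (A i) (y k)) = (\<Sum>k\<in>J. w k * indicator (\<Union>i. A i) (y k))"
      by (simp add: suminf_sum summableI suminf_indicator)
  qed
qed

section \<open>The transition law\<close>

definition transition_law ::
    "'x measure \<Rightarrow> ('x \<times> 'u \<times> 'e \<times> 'v \<Rightarrow> 'x) \<Rightarrow> 'e measure \<Rightarrow> 'v measure \<Rightarrow> 'x \<times> 'u \<Rightarrow> 'x measure" where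
  "transition_law X G \<nu>\<eta> \<nu>\<epsilon> z =
     distr (\<nu>\<eta> \<Otimes>\<^sub>M \<nu>\<epsilon>) X (\<lambda>w. G (fst z, snd z, fst w, snd w))"

lemma measurable_transition_law:
  assumes [measurable]: "G \<in> X \<Otimes>\<^sub>M U \<Otimes>\<^sub>M E \<Otimes>\<^sub>M V \<rightarrow>\<^sub>M X"
    and noise: "\<nu>\<eta> \<in> space (prob_algebra E)" "\<nu>\<epsilon> \<in> space (prob_algebra V)"
  shows "transition_law X G \<nu>\<eta> \<nu>\<epsilon> \<in> X \<Otimes>\<^sub>M U \<rightarrow>\<^sub>M prob_algebra X"
proof -
  have "(\<lambda>z. \<nu>\<eta> \<Otimes>\<^sub>M \<nu>\<epsilon>) \<in> X \<Otimes>\<^sub>M U \<rightarrow>\<^sub>M prob_algebra (E \<Otimes>\<^sub>M V)"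
    using noise by (intro measurable_pair_prob measurable_const)
  then show ?thesis
    unfolding transition_law_def[abs_def]
    by (rule measurable_distr_prob_space2) measurable
qed

lemma emeasure_transition_law:
  assumes G[measurable]: "G \<in> X \<Otimes>\<^sub>M U \<Otimes>\<^sub>M E \<Otimes>\<^sub>M V \<rightarrow>\<^sub>M X"
    and "\<nu>\<eta> \<in> space (prob_algebra E)" "\<nu>\<epsilon> \<in> space (prob_algebra V)"
    and [measurable]: "x \<in> space X" "u \<in> space U" "C \<in> sets X"
  shows "emeasure (transition_law X G \<nu>\<eta> \<nu>\<epsilon> (x, u)) C = transition_kernel G \<nu>\<eta> \<nu>\<epsilon> C x u"
proof -
  have s[measurable_cong]: "sets \<nu>\<eta> = sets E" "sets \<nu>\<epsilon> = sets V"
    and p: "prob_space \<nu>\<eta>" "prob_space \<nu>\<epsilon>"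
    using assms(2,3) by (auto simp: space_prob_algebra)
  interpret \<nu>\<epsilon>: prob_space \<nu>\<epsilon> by (rule p)
  have g[measurable]: "(\<lambda>w. G (x, u, fst w, snd w)) \<in> \<nu>\<eta> \<Otimes>\<^sub>M \<nu>\<epsilon> \<rightarrow>\<^sub>M X"
    by measurable
  have "emeasure (transition_law X G \<nu>\<eta> \<nu>\<epsilon> (x, u)) C
      = (\<integral>\<^sup>+ y. indicator C y \<partial>distr (\<nu>\<eta> \<Otimes>\<^sub>M \<nu>\<epsilon>) X (\<lambda>w. G (x, u, fst w, snd w)))"
    by (simp add: transition_law_def)
  also have "\<dots> = (\<integral>\<^sup>+ w. indicator C (G (x, u, fst w, snd w)) \<partial>(\<nu>\<eta> \<Otimes>\<^sub>M \<nu>\<epsilon>))"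
    by (rule nn_integral_distr) measurable
  also have "\<dots> = transition_kernel G \<nu>\<eta> \<nu>\<epsilon> C x u"
    unfolding transition_kernel_def by (subst \<nu>\<epsilon>.nn_integral_fst[symmetric]) simp_all
  finally show ?thesis .
qed

section \<open>Filtering with a measurable kernel and a finite partition\<close>

text \<open>
  From here on only two facts about the transition kernel matter: \<open>Q C x u\<close> is the value at \<open>C\<close> of
  a measure \<open>K (x, u)\<close>, and \<open>K\<close> is measurable into the space of probability measures.
\<close>

locale partition_filter =
  fixes X :: "'x measure" and U :: "'u measure"
    and K :: "'x \<times> 'u \<Rightarrow> 'x measure" and Q :: "'x set \<Rightarrow> 'x \<Rightarrow> 'u \<Rightarrow> ennreal"
    and r :: nat and Obs :: "nat \<Rightarrow> 'x set"
  assumes K[measurable]: "K \<in> X \<Otimes>\<^sub>M U \<rightarrow>\<^sub>M prob_algebra X"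
    and emeasure_K: "\<And>C x u. C \<in> sets X \<Longrightarrow> x \<in> space X \<Longrightarrow> u \<in> space U \<Longrightarrow> emeasure (K (x, u)) C = Q C x u"
    and sets_Obs: "\<And>j. j \<in> {1..r + 1} \<Longrightarrow> Obs j \<in> sets X"
    and disjoint_Obs: "disjoint_family_on Obs {1..r + 1}"
    and Union_Obs: "(\<Union>j\<in>{1..r + 1}. Obs j) = space X"
begin

abbreviation "J \<equiv> class_indices r Obs"

lemma sets_Obs_J[measurable]: "k \<in> J \<Longrightarrow> Obs k \<in> sets X"
  using sets_Obs by (auto simp: class_indices_def)

text \<open>
  The set function defining \<open>predict\<close> agrees on \<open>sets X\<close> with an actual measure, so the measure it
  generates is that one; the same device removes \<open>measure_of\<close> from the filter update below.
\<close>

lemma predict_eq_bind: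
  assumes \<mu>: "\<mu> \<in> space (prob_algebra X)" and u: "u \<in> space U"
  shows "predict X Q u \<mu> = \<mu> \<bind> (\<lambda>x. K (x, u))"
proof -
  have Ku: "(\<lambda>x. K (x, u)) \<in> X \<rightarrow>\<^sub>M prob_algebra X"
    using u by measurable
  have s: "sets (\<mu> \<bind> (\<lambda>x. K (x, u))) = sets X"
    by (rule sets_bind'[OF \<mu> Ku])
  have "space \<mu> = space X"
    using \<mu> by (auto simp: space_prob_algebra dest: sets_eq_imp_space_eq)
  then have "(\<integral>\<^sup>+ x. Q C x u \<partial>\<mu>) = emeasure (\<mu> \<bind> (\<lambda>x. K (x, u))) C" if "C \<in> sets X" for C
    using that u
    by (subst emeasure_bind_prob_algebra[OF \<mu> Ku]) (auto simp: emeasure_K intro!: nn_integral_cong)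
  then have "predict X Q u \<mu> = measure_of (space X) (sets X) (emeasure (\<mu> \<bind> (\<lambda>x. K (x, u))))"
    unfolding predict_def
    by (intro measure_of_eq) (auto simp: sets.space_closed sets.sigma_sets_eq)
  also have "\<dots> = \<mu> \<bind> (\<lambda>x. K (x, u))"
    using measure_of_of_measure[of "\<mu> \<bind> (\<lambda>x. K (x, u))"] s sets_eq_imp_space_eq[OF s] by simp
  finally show ?thesis .
qed

lemma measurable_predict[measurable]:
  "(\<lambda>(\<mu>, u). predict X Q u \<mu>) \<in> prob_algebra X \<Otimes>\<^sub>M U \<rightarrow>\<^sub>M prob_algebra X"
proof -
  have "(\<lambda>p. fst p \<bind> (\<lambda>x. K (x, snd p))) \<in> prob_algebra X \<Otimes>\<^sub>M U \<rightarrow>\<^sub>M prob_algebra X"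
    by measurable
  then show ?thesis
    by (rule measurable_cong[THEN iffD1, rotated])
       (auto simp: space_pair_measure predict_eq_bind)
qed

lemma predict_in_prob_algebra:
  assumes "\<mu> \<in> space (prob_algebra X)" "u \<in> space U"
  shows "predict X Q u \<mu> \<in> space (prob_algebra X)"
  using measurable_space[OF measurable_predict, of "(\<mu>, u)"] assms
  by (simp add: space_pair_measure)

lemma measurable_branch_prob[measurable]:
  assumes [measurable]: "k \<in> J"
  shows "(\<lambda>(\<mu>, u). branch_prob X Q Obs k \<mu> u) \<in> borel_measurable (prob_algebra X \<Otimes>\<^sub>M U)"
  using measurable_emeasure_kernel[OF measurable_prob_algebraD[OF measurable_predict] sets_Obs_J[OF assms]]
  by (simp add: branch_prob_def split_def)

text \<open>Empty classes carry no mass, so summing over the nonempty ones loses nothing.\<close>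

lemma sum_branch_prob:
  assumes "\<mu> \<in> space (prob_algebra X)" "u \<in> space U"
  shows "(\<Sum>k\<in>J. branch_prob X Q Obs k \<mu> u) = 1"
proof -
  let ?P = "predict X Q u \<mu>"
  have s: "sets ?P = sets X" and "prob_space ?P"
    using predict_in_prob_algebra[OF assms] by (auto simp: space_prob_algebra)
  have "(\<Sum>k\<in>J. emeasure ?P (Obs k)) = (\<Sum>k\<in>{1..r + 1}. emeasure ?P (Obs k))"
    by (rule sum.mono_neutral_left) (auto simp: class_indices_def)
  also have "\<dots> = emeasure ?P (\<Union>k\<in>{1..r + 1}. Obs k)"
    using sets_Obs disjoint_Obs by (intro sum_emeasure) (auto simp: s)
  also have "\<dots> = 1"
    using prob_space.emeasure_space_1[OF \<open>prob_space ?P\<close>] sets_eq_imp_space_eq[OF s]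
    by (simp only: Union_Obs)
  finally show ?thesis by (simp add: branch_prob_def)
qed

subsection \<open>The update is conditioning on the observed class\<close>

lemma emeasure_predict_on:
  assumes \<mu>: "\<mu> \<in> space (prob_algebra X)" "u \<in> space U" and k: "k \<in> J" and C: "C \<in> sets X"
  shows "emeasure (predict_on X Q Obs u k \<mu>) C = emeasure (predict X Q u \<mu>) (C \<inter> Obs k)"
proof -
  let ?R = "density (predict X Q u \<mu>) (indicator (Obs k))"
  have s: "sets (predict X Q u \<mu>) = sets X"
    using predict_in_prob_algebra[OF \<mu>] by (simp add: space_prob_algebra)
  have R: "emeasure (predict X Q u \<mu>) (A \<inter> Obs k) = emeasure ?R A" if "A \<in> sets X" for A
    using that sets_Obs_J[OF k]
    by (simp add: s emeasure_restricted Int_commute)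
  then have "predict_on X Q Obs u k \<mu> = measure_of (space X) (sets X) (emeasure ?R)"
    unfolding predict_on_def
    by (intro measure_of_eq) (auto simp: sets.space_closed sets.sigma_sets_eq)
  also have "\<dots> = ?R"
    using measure_of_of_measure[of ?R] s sets_eq_imp_space_eq[OF s] by simp
  finally show ?thesis using R[OF C] by simp
qed

lemma filter_update_eq_uniform_measure:
  assumes \<mu>: "\<mu> \<in> space (prob_algebra X)" "u \<in> space U" and k: "k \<in> J"
    and pos: "branch_prob X Q Obs k \<mu> u > 0"
  shows "filter_update X Q Obs \<rho> k \<mu> u = uniform_measure (predict X Q u \<mu>) (Obs k)"
proof -
  let ?R = "uniform_measure (predict X Q u \<mu>) (Obs k)"
  have s: "sets (predict X Q u \<mu>) = sets X"
    using predict_in_prob_algebra[OF \<mu>] by (simp add: space_prob_algebra)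
  have "filter_update X Q Obs \<rho> k \<mu> u = measure_of (space X) (sets X) (emeasure ?R)"
    unfolding filter_update_def using pos sets_Obs_J[OF k]
    by (simp, intro measure_of_eq)
       (auto simp: sets.space_closed sets.sigma_sets_eq emeasure_predict_on[OF \<mu> k] s
         branch_prob_def Int_commute)
  also have "\<dots> = ?R"
    using measure_of_of_measure[of ?R] s sets_eq_imp_space_eq[OF s] by simp
  finally show ?thesis .
qed

lemma filter_update_in_class_probs:
  assumes \<mu>: "\<mu> \<in> space (prob_algebra X)" "u \<in> space U" and k: "k \<in> J"
    and \<rho>: "\<rho> k \<in> class_probs X Obs k"
  shows "filter_update X Q Obs \<rho> k \<mu> u \<in> class_probs X Obs k"
proof (cases "branch_prob X Q Obs k \<mu> u > 0")
  case True
  let ?P = "predict X Q u \<mu>"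
  have s: "sets ?P = sets X" and "prob_space ?P"
    using predict_in_prob_algebra[OF \<mu>] by (auto simp: space_prob_algebra)
  interpret P: prob_space ?P by fact
  have p: "emeasure ?P (Obs k) \<noteq> 0" "emeasure ?P (Obs k) \<noteq> \<infinity>"
    using True by (auto simp: branch_prob_def)
  then have "emeasure (uniform_measure ?P (Obs k)) (Obs k) = 1"
    using sets_Obs_J[OF k] ennreal_divide_self[OF p(1)] by (simp add: s flip: less_top)
  then show ?thesis
    using prob_space_uniform_measure[OF p]
    by (simp add: filter_update_eq_uniform_measure[OF \<mu> k True] class_probs_def space_prob_algebra s)
next
  case False
  then show ?thesis using \<rho> by (simp add: filter_update_def)
qed

text \<open>
  The \<open>\<sigma>\<close>-field of \<open>\<P>(X)\<close> is generated by evaluations, so it suffices that each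
  \<open>(\<mu>, u) \<mapsto> \<Phi>\<^sub>k(\<mu>, u)(A)\<close> is measurable; these are explicit, piecewise on \<open>{p\<^sub>k > 0}\<close> and its complement.
\<close>

lemma measurable_filter_update[measurable]:
  assumes k[measurable]: "k \<in> J" and \<rho>: "\<rho> k \<in> class_probs X Obs k"
  shows "(\<lambda>(\<mu>, u). filter_update X Q Obs \<rho> k \<mu> u) \<in> prob_algebra X \<Otimes>\<^sub>M U \<rightarrow>\<^sub>M prob_algebra X"
proof (rule measurable_prob_algebra_generated[where \<Omega> = "space X" and G = "sets X"])
  let ?\<Phi> = "\<lambda>(\<mu>, u). filter_update X Q Obs \<rho> k \<mu> u"
  have \<Phi>: "?\<Phi> p \<in> space (prob_algebra X)" if "p \<in> space (prob_algebra X \<Otimes>\<^sub>M U)" for p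
    using that filter_update_in_class_probs[where \<rho>=\<rho>, OF _ _ k \<rho>]
    by (auto simp: space_pair_measure class_probs_def)
  then show "\<And>p. p \<in> space (prob_algebra X \<Otimes>\<^sub>M U) \<Longrightarrow> prob_space (?\<Phi> p)"
    "\<And>p. p \<in> space (prob_algebra X \<Otimes>\<^sub>M U) \<Longrightarrow> sets (?\<Phi> p) = sets X"
    by (auto simp: space_prob_algebra)
  fix A assume A[measurable]: "A \<in> sets X"
  let ?e = "\<lambda>(\<mu>, u). if branch_prob X Q Obs k \<mu> u > 0
      then emeasure (predict X Q u \<mu>) (Obs k \<inter> A) / branch_prob X Q Obs k \<mu> u else emeasure (\<rho> k) A"
  have ev: "(\<lambda>p. emeasure ((\<lambda>(\<mu>, u). predict X Q u \<mu>) p) (Obs k \<inter> A))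
      \<in> borel_measurable (prob_algebra X \<Otimes>\<^sub>M U)"
    by (rule measurable_emeasure_kernel[OF measurable_prob_algebraD[OF measurable_predict]]) measurable
  have [measurable]: "(\<lambda>p. branch_prob X Q Obs k (fst p) (snd p)) \<in> borel_measurable (prob_algebra X \<Otimes>\<^sub>M U)"
    "(\<lambda>p. emeasure (predict X Q (snd p) (fst p)) (Obs k \<inter> A)) \<in> borel_measurable (prob_algebra X \<Otimes>\<^sub>M U)"
    using measurable_branch_prob[OF k] ev by (simp_all add: split_def)
  have "?e \<in> borel_measurable (prob_algebra X \<Otimes>\<^sub>M U)"
    unfolding split_def by measurable
  moreover have "emeasure (?\<Phi> p) A = ?e p" if p: "p \<in> space (prob_algebra X \<Otimes>\<^sub>M U)" for p
  proof -
    obtain \<mu> u where [simp]: "p = (\<mu>, u)" by (cases p)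
    have \<mu>: "\<mu> \<in> space (prob_algebra X)" "u \<in> space U"
      using p by (auto simp: space_pair_measure)
    have s: "sets (predict X Q u \<mu>) = sets X"
      using predict_in_prob_algebra[OF \<mu>] by (simp add: space_prob_algebra)
    show ?thesis
      using filter_update_eq_uniform_measure[OF \<mu> k, of \<rho>] sets_Obs_J[OF k] A
      by (auto simp: filter_update_def branch_prob_def s)
  qed
  ultimately show "(\<lambda>p. emeasure (?\<Phi> p) A) \<in> borel_measurable (prob_algebra X \<Otimes>\<^sub>M U)"
    by (simp cong: measurable_cong)
qed (auto simp: sets.sigma_sets_eq sets.Int_stable sets.space_closed)

section \<open>The kernel on the information space\<close>

lemma space_info_space:
  "space (info_space X r Obs) = (SIGMA j:J. class_probs X Obs j)"
  by (auto simp: info_space_def space_restrict_space space_pair_measure class_probs_def)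

lemma measurable_info_belief:
  "(\<lambda>(I, u). (snd I, u)) \<in> info_space X r Obs \<Otimes>\<^sub>M U \<rightarrow>\<^sub>M prob_algebra X \<Otimes>\<^sub>M U"
proof -
  have [measurable]: "snd \<in> info_space X r Obs \<rightarrow>\<^sub>M prob_algebra X"
    unfolding info_space_def by (intro measurable_restrict_space1 measurable_snd)
  show ?thesis by measurable
qed

lemma \<Psi>_in_info_space:
  assumes "I \<in> space (info_space X r Obs)" "u \<in> space U" "k \<in> J" "\<rho> k \<in> class_probs X Obs k"
  shows "\<Psi> X Q Obs \<rho> I u k \<in> space (info_space X r Obs)"
  using assms filter_update_in_class_probs[of "snd I" u k \<rho>]
  by (auto simp: space_info_space \<Psi>_def class_probs_def)

text \<open>
  The information space carries a trace \<open>\<sigma>\<close>-field, so measurability into it splits into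
  measurability into the ambient product and the support condition that the update charges the
  observed class.
\<close>

lemma measurable_\<Psi>:
  assumes k: "k \<in> J" and \<rho>: "\<rho> k \<in> class_probs X Obs k"
  shows "(\<lambda>(I, u). \<Psi> X Q Obs \<rho> I u k) \<in> info_space X r Obs \<Otimes>\<^sub>M U \<rightarrow>\<^sub>M info_space X r Obs"
proof -
  let ?M = "info_space X r Obs \<Otimes>\<^sub>M U"
  have "(\<lambda>(I, u). \<Psi> X Q Obs \<rho> I u k) \<in> space ?M \<rightarrow> space (info_space X r Obs)"
    using \<Psi>_in_info_space[where \<rho>=\<rho>, OF _ _ k \<rho>] by (auto simp: space_pair_measure)
  moreover have "(\<lambda>(I, u). filter_update X Q Obs \<rho> k (snd I) u) \<in> ?M \<rightarrow>\<^sub>M prob_algebra X"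
    using measurable_compose[OF measurable_info_belief measurable_filter_update[where \<rho>=\<rho>, OF k \<rho>]]
    by (simp add: split_def)
  then have "(\<lambda>(I, u). \<Psi> X Q Obs \<rho> I u k) \<in> ?M \<rightarrow>\<^sub>M count_space J \<Otimes>\<^sub>M prob_algebra X"
    using k by (simp add: \<Psi>_def split_def)
  ultimately show ?thesis
    unfolding space_info_space unfolding info_space_def by (intro measurable_restrict_space2)
qed

lemma measurable_\<theta>:
  assumes "k \<in> J"
  shows "(\<lambda>(I, u). \<theta> X Q Obs k I u) \<in> borel_measurable (info_space X r Obs \<Otimes>\<^sub>M U)"
  using measurable_compose[OF measurable_info_belief measurable_branch_prob[OF assms]]
  by (simp add: \<theta>_def split_def)

lemma measurable_info_kernel:
  assumes \<rho>: "\<And>k. k \<in> J \<Longrightarrow> \<rho> k \<in> class_probs X Obs k" and D: "D \<in> sets (info_space X r Obs)"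
  shows "(\<lambda>(I, u). info_kernel X Q r Obs \<rho> D I u) \<in> borel_measurable (info_space X r Obs \<Otimes>\<^sub>M U)"
proof -
  have "(\<lambda>p. \<theta> X Q Obs k (fst p) (snd p) * indicator D (\<Psi> X Q Obs \<rho> (fst p) (snd p) k))
      \<in> borel_measurable (info_space X r Obs \<Otimes>\<^sub>M U)" if "k \<in> J" for k
  proof (rule borel_measurable_times_ennreal)
    show "(\<lambda>p. \<theta> X Q Obs k (fst p) (snd p)) \<in> borel_measurable (info_space X r Obs \<Otimes>\<^sub>M U)"
      using measurable_\<theta>[OF that] by (simp add: split_def)
    show "(\<lambda>p. indicator D (\<Psi> X Q Obs \<rho> (fst p) (snd p) k)) \<in> borel_measurable (info_space X r Obs \<Otimes>\<^sub>M U)"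
      using measurable_compose[OF measurable_\<Psi>[where \<rho>=\<rho>, OF that \<rho>[OF that]] borel_measurable_indicator[OF D]]
      by (simp add: split_def)
  qed
  then show ?thesis
    by (simp add: info_kernel_def split_def)
qed

lemma info_kernel_space:
  assumes I: "I \<in> space (info_space X r Obs)" "u \<in> space U"
    and \<rho>: "\<And>k. k \<in> J \<Longrightarrow> \<rho> k \<in> class_probs X Obs k"
  shows "info_kernel X Q r Obs \<rho> (space (info_space X r Obs)) I u = 1"
proof -
  have "info_kernel X Q r Obs \<rho> (space (info_space X r Obs)) I u
      = (\<Sum>k\<in>J. branch_prob X Q Obs k (snd I) u)"
    unfolding info_kernel_def using \<Psi>_in_info_space[where \<rho>=\<rho>, OF I] \<rho>
    by (intro sum.cong) (auto simp: \<theta>_def)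
  also have "\<dots> = 1"
    using I by (intro sum_branch_prob) (auto simp: space_info_space class_probs_def)
  finally show ?thesis .
qed

end

text \<open>
  The default \<open>\<rho>\<^sub>k\<close> is used exactly when the weight \<open>p\<^sub>k\<close> vanishes, so the kernels agree term by term.
\<close>

lemma info_kernel_independent_of_default:
  "info_kernel X Q r Obs \<rho>' D I u = info_kernel X Q r Obs \<rho> D I u"
proof -
  have "\<theta> X Q Obs k I u * indicator D (\<Psi> X Q Obs \<rho>' I u k)
      = \<theta> X Q Obs k I u * indicator D (\<Psi> X Q Obs \<rho> I u k)" for k
    by (cases "branch_prob X Q Obs k (snd I) u > 0")
       (auto simp: \<theta>_def \<Psi>_def filter_update_def)
  then show ?thesis by (simp add: info_kernel_def)
qed

section \<open>The information kernel is a stochastic kernel\<close>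

theorem proposition9:
  fixes X :: "'x measure" and U :: "'u measure" and E :: "'e measure" and V :: "'v measure"
    and G :: "'x \<times> 'u \<times> 'e \<times> 'v \<Rightarrow> 'x"
    and \<nu>\<eta> :: "'e measure" and \<nu>\<epsilon> :: "'v measure"
    and r :: nat and Obs :: "nat \<Rightarrow> 'x set"
    and Adm :: "'x \<Rightarrow> 'u set"
    and \<rho> :: "nat \<Rightarrow> 'x measure"
  defines "Q \<equiv> transition_kernel G \<nu>\<eta> \<nu>\<epsilon>"
  assumes "standard_borel_space X" and "standard_borel_space U"
    and "standard_borel_space E" and "standard_borel_space V"
    and "G \<in> X \<Otimes>\<^sub>M U \<Otimes>\<^sub>M E \<Otimes>\<^sub>M V \<rightarrow>\<^sub>M X"
    and "\<nu>\<eta> \<in> space (prob_algebra E)" and "\<nu>\<epsilon> \<in> space (prob_algebra V)"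
    and "\<And>j. j \<in> {1..r + 1} \<Longrightarrow> Obs j \<in> sets X"
    and "disjoint_family_on Obs {1..r + 1}"
    and "(\<Union>j\<in>{1..r + 1}. Obs j) = space X"
    and "\<And>x. x \<in> space X \<Longrightarrow> Adm x \<noteq> {} \<and> Adm x \<subseteq> space U"
    and "\<And>k. k \<in> class_indices r Obs \<Longrightarrow> \<rho> k \<in> class_probs X Obs k"
  shows "stochastic_kernel_given (info_space X r Obs) U (info_graph X U r Obs Adm)
           (info_kernel X Q r Obs \<rho>) \<and>
         (\<forall>\<rho>'. (\<forall>k\<in>class_indices r Obs. \<rho>' k \<in> class_probs X Obs k) \<longrightarrow>
           (\<forall>(I, u)\<in>info_graph X U r Obs Adm. \<forall>D\<in>sets (info_space X r Obs).
             info_kernel X Q r Obs \<rho>' D I u = info_kernel X Q r Obs \<rho> D I u))"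
proof -
  let ?S = "info_space X r Obs" and ?Gr = "info_graph X U r Obs Adm"
  note G = assms(6) and noise = assms(7,8) and \<rho> = assms(13)
  interpret partition_filter X U "transition_law X G \<nu>\<eta> \<nu>\<epsilon>" Q r Obs
    using measurable_transition_law[OF G noise] emeasure_transition_law[OF G noise] assms(9-11)
    by unfold_locales (auto simp: Q_def)
  have "measure_space (space ?S) (sets ?S) (\<lambda>D. info_kernel X Q r Obs \<rho> D I u)" for I u
    unfolding info_kernel_def by (rule measure_space_finite_point_masses)
  moreover have "info_kernel X Q r Obs \<rho> (space ?S) I u = 1" if "(I, u) \<in> ?Gr" for I u
    using that \<rho> by (intro info_kernel_space) (auto simp: info_graph_def)
  moreover have "(\<lambda>(I, u). info_kernel X Q r Obs \<rho> D I u) \<in> borel_measurable (restrict_space (?S \<Otimes>\<^sub>M U) ?Gr)"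
    if "D \<in> sets ?S" for D
    using \<rho> that by (intro measurable_restrict_space1 measurable_info_kernel)
  ultimately have "stochastic_kernel_given ?S U ?Gr (info_kernel X Q r Obs \<rho>)"
    by (auto simp: stochastic_kernel_given_def)
  moreover have "info_kernel X Q r Obs \<rho>' D I u = info_kernel X Q r Obs \<rho> D I u" for \<rho>' D I u
    by (rule info_kernel_independent_of_default)
  ultimately show ?thesis
    by blast
qed

end
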